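(* Let $B=\mathbb{Z}[a_1,a_2,\ldots]$ be the polynomial ring over $\mathbb{Z}$ in infinitely many indeterminates $a_1,a_2,\ldots$, put $a_0=1$, and let $A=B\otimes\mathbb{Q}$. Let $G_U(x)=\sum_{k=0}^\infty a_k\frac{x^{k+1}}{k+1}\in A\llbracket x\rrbracket$, and let $G_U^{-1}$ denote its compositional inverse. Define $$\Phi_U(x,y):=G_U^{-1}\left(G_U(x)+G_U(y)\right),\qquad \Psi_U(x,y):=G_U^{-1}\left(G_U(x)\cdot G_U(y)\right).$$ Then $(A,\Phi_U,\Psi_U)$ is a (one-dimensional) formal ring over the base ring $A=B\otimes\mathbb{Q}$.
   Context: All rings are associative, commutative and unital. For a ring $A$, a commutative one-dimensional formal group law over $A$ is a power series $\Phi(x,y)\in A\llbracket x,y\rrbracket$ with $\Phi(x,0)=\Phi(0,x)=x$, $\Phi(\Phi(x,y),z)=\Phi(x,\Phi(y,z))$ and $\Phi(x,y)=\Phi(y,x)$. A (one-dimensional) formal ring over a base ring $A$ is a triple $(A,\Phi,\Psi)$ with $\Phi(x,y),\Psi(x,y)\in A\llbracket x,y\rrbracket$ (where $\Psi$ has zero constant term, so that the substitutions below make sense) such that $\Phi$ is a commutative formal group law and the following identities of formal power series hold: $\Psi(\Psi(x,y),z)=\Psi(x,\Psi(y,z))$, $\Psi(x,\Phi(y,z))=\Phi(\Psi(x,y),\Psi(x,z))$, $\Psi(\Phi(x,y),z)=\Phi(\Psi(x,z),\Psi(y,z))$. *)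

theory Defs
  imports "HOL-Computational_Algebra.Formal_Power_Series" "HOL-Library.Poly_Mapping"
begin

unbundle fps_syntax

section \<open>Formal power series in two and three variables\<close>

text \<open>
  Power series in several variables are iterated univariate ones, the outermost variable being
  \<open>x\<close>: the coefficient of \<open>x\<^sup>i y\<^sup>j\<close> in \<open>F\<close> is \<open>F $ i $ j\<close>, and that of
  \<open>x\<^sup>i y\<^sup>j z\<^sup>k\<close> is \<open>F $ i $ j $ k\<close>.
\<close>

type_synonym 'a fps2 = "'a fps fps"
type_synonym 'a fps3 = "'a fps fps fps"

definition x2 :: "'a::comm_ring_1 fps2" where "x2 = fps_X"
definition y2 :: "'a::comm_ring_1 fps2" where "y2 = fps_const fps_X"

definition x3 :: "'a::comm_ring_1 fps3" where "x3 = fps_X"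
definition y3 :: "'a::comm_ring_1 fps3" where "y3 = fps_const fps_X"
definition z3 :: "'a::comm_ring_1 fps3" where "z3 = fps_const (fps_const fps_X)"

text \<open>
  Substitution of series without constant term, as in \<^const>\<open>fps_compose\<close>: \<open>f(u) = \<Sum>\<^sub>p f\<^sub>p u\<^sup>p\<close> and
  \<open>F(u,v) = \<Sum>\<^sub>p\<^sub>,\<^sub>q F\<^sub>p\<^sub>q u\<^sup>p v\<^sup>q\<close>. Only finitely many terms contribute to a
  given coefficient, see \<open>power2_nth_eq_0\<close> and \<open>power_mult_power3_nth_eq_0\<close> below.
\<close>

definition subst_1_2 :: "'a::comm_ring_1 fps \<Rightarrow> 'a fps2 \<Rightarrow> 'a fps2" where
  "subst_1_2 f u = Abs_fps (\<lambda>i. Abs_fps (\<lambda>j. \<Sum>p\<le>i+j. f $ p * (u ^ p) $ i $ j))"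

definition subst_2_3 :: "'a::comm_ring_1 fps2 \<Rightarrow> 'a fps3 \<Rightarrow> 'a fps3 \<Rightarrow> 'a fps3" where
  "subst_2_3 F u v = Abs_fps (\<lambda>i. Abs_fps (\<lambda>j. Abs_fps (\<lambda>k.
     \<Sum>p\<le>i+j+k. \<Sum>q\<le>i+j+k. F $ p $ q * (u ^ p * v ^ q) $ i $ j $ k)))"

lemma mult2_nth_eq_0:
  fixes u v :: "'a::comm_ring_1 fps2"
  assumes "\<And>i j. i + j < m \<Longrightarrow> u $ i $ j = 0" and "\<And>i j. i + j < n \<Longrightarrow> v $ i $ j = 0"
    and "i + j < m + n"
  shows "(u * v) $ i $ j = 0"
proof -
  have "u $ a $ b * v $ (i - a) $ (j - b) = 0" if "a \<le> i" "b \<le> j" for a b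
  proof (cases "a + b < m")
    case False
    then have "(i - a) + (j - b) < n" using assms(3) that by linarith
    then show ?thesis using assms(2) by simp
  qed (use assms(1) in simp)
  then show ?thesis
    by (auto simp: fps_mult_nth fps_sum_nth intro!: sum.neutral)
qed

lemma power2_nth_eq_0:
  fixes u :: "'a::comm_ring_1 fps2"
  assumes "u $ 0 $ 0 = 0" and "i + j < p"
  shows "(u ^ p) $ i $ j = 0"
  using assms(2)
proof (induction p arbitrary: i j)
  case (Suc p)
  have "u $ a $ b = 0" if "a + b < 1" for a b
    using that assms(1) by simp
  with Suc show ?case
    using mult2_nth_eq_0[of 1 u p "u ^ p" i j] by simp
qed simp

lemma mult3_nth_eq_0:
  fixes u v :: "'a::comm_ring_1 fps3"
  assumes "\<And>i j k. i + j + k < m \<Longrightarrow> u $ i $ j $ k = 0"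
    and "\<And>i j k. i + j + k < n \<Longrightarrow> v $ i $ j $ k = 0"
    and "i + j + k < m + n"
  shows "(u * v) $ i $ j $ k = 0"
proof -
  have "u $ a $ b $ c * v $ (i - a) $ (j - b) $ (k - c) = 0" if "a \<le> i" "b \<le> j" "c \<le> k" for a b c
  proof (cases "a + b + c < m")
    case False
    then have "(i - a) + (j - b) + (k - c) < n" using assms(3) that by linarith
    then show ?thesis using assms(2) by simp
  qed (use assms(1) in simp)
  then show ?thesis
    by (auto simp: fps_mult_nth fps_sum_nth intro!: sum.neutral)
qed

lemma power3_nth_eq_0:
  fixes u :: "'a::comm_ring_1 fps3"
  assumes "u $ 0 $ 0 $ 0 = 0" and "i + j + k < p"
  shows "(u ^ p) $ i $ j $ k = 0"
  using assms(2)
proof (induction p arbitrary: i j k)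
  case (Suc p)
  have "u $ a $ b $ c = 0" if "a + b + c < 1" for a b c
    using that assms(1) by simp
  with Suc show ?case
    using mult3_nth_eq_0[of 1 u p "u ^ p" i j k] by simp
qed simp

lemma power_mult_power3_nth_eq_0:
  fixes u v :: "'a::comm_ring_1 fps3"
  assumes "u $ 0 $ 0 $ 0 = 0" "v $ 0 $ 0 $ 0 = 0" and "i + j + k < p + q"
  shows "(u ^ p * v ^ q) $ i $ j $ k = 0"
  using assms by (intro mult3_nth_eq_0[of p _ q] power3_nth_eq_0)


section \<open>Formal group laws and formal rings\<close>

text \<open>
  All identities are stated in \<open>A[[x,y,z]]\<close>. The first two conditions of \<open>formal_group_law\<close> force
  the constant term of \<open>\<Phi>\<close> to vanish, as the substitutions require.
\<close>

definition formal_group_law :: "'a::comm_ring_1 fps2 \<Rightarrow> bool" where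
  "formal_group_law \<Phi> \<longleftrightarrow>
     subst_2_3 \<Phi> x3 0 = x3 \<and>
     subst_2_3 \<Phi> 0 x3 = x3 \<and>
     subst_2_3 \<Phi> (subst_2_3 \<Phi> x3 y3) z3 = subst_2_3 \<Phi> x3 (subst_2_3 \<Phi> y3 z3) \<and>
     subst_2_3 \<Phi> x3 y3 = subst_2_3 \<Phi> y3 x3"

definition formal_ring :: "'a::comm_ring_1 fps2 \<Rightarrow> 'a fps2 \<Rightarrow> bool" where
  "formal_ring \<Phi> \<Psi> \<longleftrightarrow>
     formal_group_law \<Phi> \<and>
     \<Psi> $ 0 $ 0 = 0 \<and>
     subst_2_3 \<Psi> (subst_2_3 \<Psi> x3 y3) z3 = subst_2_3 \<Psi> x3 (subst_2_3 \<Psi> y3 z3) \<and>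
     subst_2_3 \<Psi> x3 (subst_2_3 \<Phi> y3 z3) = subst_2_3 \<Phi> (subst_2_3 \<Psi> x3 y3) (subst_2_3 \<Psi> x3 z3) \<and>
     subst_2_3 \<Psi> (subst_2_3 \<Phi> x3 y3) z3 = subst_2_3 \<Phi> (subst_2_3 \<Psi> x3 z3) (subst_2_3 \<Psi> y3 z3)"


section \<open>The base ring\<close>

text \<open>
  A monomial is an exponent vector \<open>nat \<Rightarrow>\<^sub>0 nat\<close> and a polynomial a finitely supported function on
  monomials, with the convolution product of \<open>Poly_Mapping\<close>. The variable with index \<open>k\<close> is
  \<open>a\<^bsub>k+1\<^esub>\<close>. \<open>B \<otimes> \<rat>\<close> is realised as \<open>\<rat>[a\<^sub>1, a\<^sub>2, \<dots>]\<close> with the structure maps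
  \<open>\<iota>\<^sub>B\<close> and \<open>\<iota>\<^sub>Q\<close>; its universal property as a coproduct of commutative rings is
  \<open>tensor_universal\<close> below.
\<close>

type_synonym B_ring = "(nat \<Rightarrow>\<^sub>0 nat) \<Rightarrow>\<^sub>0 int"
type_synonym A_ring = "(nat \<Rightarrow>\<^sub>0 nat) \<Rightarrow>\<^sub>0 rat"

definition a_var :: "nat \<Rightarrow> B_ring" where
  "a_var k = (case k of 0 \<Rightarrow> 1 | Suc i \<Rightarrow> Poly_Mapping.single (Poly_Mapping.single i 1) 1)"

definition \<iota>\<^sub>B :: "B_ring \<Rightarrow> A_ring" where
  "\<iota>\<^sub>B = Poly_Mapping.map of_int"

definition \<iota>\<^sub>Q :: "rat \<Rightarrow> A_ring" where
  "\<iota>\<^sub>Q c = Poly_Mapping.single 0 c"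

definition is_ring_hom :: "('a::comm_ring_1 \<Rightarrow> 'b::comm_ring_1) \<Rightarrow> bool" where
  "is_ring_hom f \<longleftrightarrow> f 1 = 1 \<and> (\<forall>x y. f (x + y) = f x + f y) \<and> (\<forall>x y. f (x * y) = f x * f y)"

lemma is_ring_hom_0: "is_ring_hom f \<Longrightarrow> f 0 = 0"
  unfolding is_ring_hom_def by (metis add_cancel_right_right)

lemma poly_mapping_single_add_induct:
  fixes p :: "'k \<Rightarrow>\<^sub>0 'c::comm_monoid_add"
  assumes "P 0" and "\<And>m c. P (Poly_Mapping.single m c)" and "\<And>p q. P p \<Longrightarrow> P q \<Longrightarrow> P (p + q)"
  shows "P p"
proof -
  have "p = (\<Sum>m\<in>Poly_Mapping.keys p. Poly_Mapping.single m (Poly_Mapping.lookup p m))"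
    by (rule poly_mapping_eqI)
       (auto simp: lookup_sum lookup_single when_def in_keys_iff)
  moreover have "P (\<Sum>m\<in>M. Poly_Mapping.single m (Poly_Mapping.lookup p m))" for M
    by (induction M rule: infinite_finite_induct) (auto intro: assms)
  ultimately show ?thesis by metis
qed

lemma lookup_\<iota>\<^sub>B: "Poly_Mapping.lookup (\<iota>\<^sub>B p) m = of_int (Poly_Mapping.lookup p m)"
  unfolding \<iota>\<^sub>B_def by (simp add: Poly_Mapping.map.rep_eq when_def)

lemma \<iota>\<^sub>B_single: "\<iota>\<^sub>B (Poly_Mapping.single m c) = Poly_Mapping.single m (of_int c)"
  by (rule poly_mapping_eqI) (simp add: lookup_\<iota>\<^sub>B lookup_single when_def)

lemma \<iota>\<^sub>B_add: "\<iota>\<^sub>B (p + q) = \<iota>\<^sub>B p + \<iota>\<^sub>B q"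
  by (rule poly_mapping_eqI) (simp add: lookup_\<iota>\<^sub>B lookup_add)

lemma additive_multiplicativeI:
  fixes h :: "('k::comm_monoid_add \<Rightarrow>\<^sub>0 'c::comm_ring_1) \<Rightarrow> 'r::comm_ring_1"
  assumes add: "\<And>p q. h (p + q) = h p + h q"
    and single: "\<And>m n c d. h (Poly_Mapping.single m c * Poly_Mapping.single n d) =
                   h (Poly_Mapping.single m c) * h (Poly_Mapping.single n d)"
  shows "h (p * q) = h p * h q"
proof -
  have h0: "h 0 = 0" using add[of 0 0] by simp
  have *: "h (Poly_Mapping.single m c * q) = h (Poly_Mapping.single m c) * h q" for m c
    by (induction q rule: poly_mapping_single_add_induct)
       (auto simp: h0 single distrib_left add)
  show ?thesis
    by (induction p rule: poly_mapping_single_add_induct)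
       (auto simp: h0 * distrib_right add)
qed

lemma is_ring_hom_\<iota>\<^sub>B: "is_ring_hom \<iota>\<^sub>B"
proof -
  have "\<iota>\<^sub>B 1 = 1"
    using \<iota>\<^sub>B_single[of 0 1] by simp
  moreover have "\<iota>\<^sub>B (p * q) = \<iota>\<^sub>B p * \<iota>\<^sub>B q" for p q
    by (rule additive_multiplicativeI) (auto simp: \<iota>\<^sub>B_add \<iota>\<^sub>B_single mult_single)
  ultimately show ?thesis by (simp add: is_ring_hom_def \<iota>\<^sub>B_add)
qed

lemma is_ring_hom_\<iota>\<^sub>Q: "is_ring_hom \<iota>\<^sub>Q"
  by (simp add: is_ring_hom_def \<iota>\<^sub>Q_def single_add mult_single)

theorem tensor_universal:
  fixes f :: "B_ring \<Rightarrow> 'r::comm_ring_1" and g :: "rat \<Rightarrow> 'r"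
  assumes f: "is_ring_hom f" and g: "is_ring_hom g"
  shows "\<exists>!h. is_ring_hom h \<and> h \<circ> \<iota>\<^sub>B = f \<and> h \<circ> \<iota>\<^sub>Q = g"
proof (rule ex_ex1I)
  note f' = f[unfolded is_ring_hom_def] and g' = g[unfolded is_ring_hom_def]
  define t where "t p m = g (Poly_Mapping.lookup p m) * f (Poly_Mapping.single m 1)"
    for p :: A_ring and m
  define h where "h p = (\<Sum>m\<in>Poly_Mapping.keys p. t p m)" for p
  have h_eq: "h p = (\<Sum>m\<in>M. t p m)" if "finite M" "Poly_Mapping.keys p \<subseteq> M" for p M
    unfolding h_def using that
    by (intro sum.mono_neutral_left) (auto simp: t_def in_keys_iff is_ring_hom_0[OF g])
  have h_add: "h (p + q) = h p + h q" for p q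
  proof -
    let ?M = "Poly_Mapping.keys p \<union> Poly_Mapping.keys q"
    have "h (p + q) = (\<Sum>m\<in>?M. t (p + q) m)"
      by (rule h_eq) (use Poly_Mapping.keys_add[of p q] in auto)
    also have "\<dots> = (\<Sum>m\<in>?M. t p m) + (\<Sum>m\<in>?M. t q m)"
      by (simp add: t_def lookup_add g' distrib_right sum.distrib)
    also have "\<dots> = h p + h q"
      by (simp add: h_eq[of ?M])
    finally show ?thesis .
  qed
  have h_single: "h (Poly_Mapping.single m c) = g c * f (Poly_Mapping.single m 1)" for m c
    by (subst h_eq[of "{m}"]) (auto simp: t_def)
  have f_mono: "f (Poly_Mapping.single (m + n) 1) =
      f (Poly_Mapping.single m 1) * f (Poly_Mapping.single n 1)" for m n
    using f' by (metis mult_single mult_1)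
  have "h (p * q) = h p * h q" for p q
    by (rule additive_multiplicativeI) (auto simp: h_add h_single mult_single f_mono g' mult_ac)
  moreover have "h 1 = 1"
    using h_single[of 0 1] f' g' by simp
  ultimately have hom: "is_ring_hom h"
    by (simp add: is_ring_hom_def h_add)
  have g_int: "g (of_int c) * f (Poly_Mapping.single m 1) = f (Poly_Mapping.single m c)" for c m
  proof (induction c rule: int_induct[where k = 0])
    case base
    then show ?case by (simp add: is_ring_hom_0[OF f] is_ring_hom_0[OF g])
  next
    case (step1 i)
    then show ?case using f' g' by (simp add: single_add distrib_right)
  next
    case (step2 i)
    have "g (of_int (i - 1)) + 1 = g (of_int i)"
      using g' by (metis add.commute diff_add_cancel of_int_1 of_int_add)
    moreover have "f (Poly_Mapping.single m (i - 1)) + f (Poly_Mapping.single m 1)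
        = f (Poly_Mapping.single m i)"
      using f' by (metis diff_add_cancel single_add)
    ultimately show ?case using step2
      by (metis add_right_cancel distrib_right mult_1)
  qed
  have "h (\<iota>\<^sub>B p) = f p" for p
    by (induction p rule: poly_mapping_single_add_induct)
       (auto simp: \<iota>\<^sub>B_add h_add f' \<iota>\<^sub>B_single h_single g_int
          is_ring_hom_0[OF f] is_ring_hom_0[OF hom] is_ring_hom_0[OF is_ring_hom_\<iota>\<^sub>B])
  moreover have "h (\<iota>\<^sub>Q c) = g c" for c
    using f' by (simp add: \<iota>\<^sub>Q_def h_single)
  ultimately show "\<exists>h. is_ring_hom h \<and> h \<circ> \<iota>\<^sub>B = f \<and> h \<circ> \<iota>\<^sub>Q = g"
    using hom by (auto simp: fun_eq_iff)
next
  fix h h' :: "A_ring \<Rightarrow> 'r"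
  assume h: "is_ring_hom h \<and> h \<circ> \<iota>\<^sub>B = f \<and> h \<circ> \<iota>\<^sub>Q = g"
    and h': "is_ring_hom h' \<and> h' \<circ> \<iota>\<^sub>B = f \<and> h' \<circ> \<iota>\<^sub>Q = g"
  have single: "Poly_Mapping.single m c = \<iota>\<^sub>Q c * \<iota>\<^sub>B (Poly_Mapping.single m 1)" for m c
    by (simp add: \<iota>\<^sub>Q_def \<iota>\<^sub>B_single mult_single)
  have "h (\<iota>\<^sub>Q c) = h' (\<iota>\<^sub>Q c)" "h (\<iota>\<^sub>B p) = h' (\<iota>\<^sub>B p)" for c p
    using h h' by (metis comp_apply)+
  then have "h (Poly_Mapping.single m c) = h' (Poly_Mapping.single m c)" for m c
    using h h' by (simp add: single is_ring_hom_def)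
  then have "h p = h' p" for p
    by (induction p rule: poly_mapping_single_add_induct)
       (use h h' is_ring_hom_0[of h] is_ring_hom_0[of h'] in \<open>auto simp: is_ring_hom_def\<close>)
  then show "h = h'" by auto
qed


section \<open>The series\<close>

text \<open>The library's \<open>fps_inv\<close> needs a coefficient ring with division.\<close>

definition comp_inverse :: "'a::comm_ring_1 fps \<Rightarrow> 'a fps" where
  "comp_inverse f = (THE g. g $ 0 = 0 \<and> f oo g = fps_X \<and> g oo f = fps_X)"

definition G\<^sub>U :: "A_ring fps" where
  "G\<^sub>U = Abs_fps (\<lambda>n. case n of 0 \<Rightarrow> 0 | Suc k \<Rightarrow> \<iota>\<^sub>B (a_var k) * \<iota>\<^sub>Q (1 / of_nat (k + 1)))"

definition \<Phi>\<^sub>U :: "A_ring fps2" where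
  "\<Phi>\<^sub>U = subst_1_2 (comp_inverse G\<^sub>U) (subst_1_2 G\<^sub>U x2 + subst_1_2 G\<^sub>U y2)"

definition \<Psi>\<^sub>U :: "A_ring fps2" where
  "\<Psi>\<^sub>U = subst_1_2 (comp_inverse G\<^sub>U) (subst_1_2 G\<^sub>U x2 * subst_1_2 G\<^sub>U y2)"

end

theory Submission
  imports Defs
begin

text \<open>
  The logarithm \<open>G\<close> transports the ring structure of the affine line to the formal ring. Writing
  \<open>H\<close> for its compositional inverse, \<open>\<Phi>(u,v) = H(G(u) + G(v))\<close> and \<open>\<Psi>(u,v) = H(G(u) \<cdot> G(v))\<close>, so
  that \<open>G(\<Phi>(u,v)) = G(u) + G(v)\<close> and \<open>G(\<Psi>(u,v)) = G(u) \<cdot> G(v)\<close>. Hence both sides of each formal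
  ring axiom are \<open>H\<close> applied to the two sides of the corresponding axiom of commutative rings, for
  the elements \<open>G(x), G(y), G(z)\<close> of \<open>A[[x,y,z]]\<close>. This works for every \<open>G\<close> without constant term
  that has a compositional inverse (\<open>formal_ring_of_log\<close>); \<open>G\<^sub>U\<close> has one because its
  linear coefficient is \<open>a\<^sub>0 = 1\<close>.

  The substance of the proof is therefore that substitution behaves as expected: iterated
  substitutions can be reassociated (\<open>subst_2_3_subst_1_2\<close>, \<open>subst_1_3_compose\<close>) and
  \<open>subst_2_3 _ u v\<close> respects sums and products. All of this is shown by one
  density argument. Filter the power series rings by total degree. Two additive maps into
  \<open>A[[x,y,z]]\<close> that do not lower the filtration are equal as soon as they agree on monomials,
  because every series is a finite sum of monomials up to terms of arbitrarily high degree
  (\<open>eq_if_eq_on_monomials\<close>). On monomials, each of these identities is plain algebra.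
\<close>

section \<open>Additive maps determined by their values on monomials\<close>

definition ord1_ge :: "nat \<Rightarrow> 'a::comm_ring_1 fps \<Rightarrow> bool" where
  "ord1_ge n f \<longleftrightarrow> (\<forall>i<n. f $ i = 0)"

definition ord2_ge :: "nat \<Rightarrow> 'a::comm_ring_1 fps2 \<Rightarrow> bool" where
  "ord2_ge n F \<longleftrightarrow> (\<forall>i j. i + j < n \<longrightarrow> F $ i $ j = 0)"

definition ord3_ge :: "nat \<Rightarrow> 'a::comm_ring_1 fps3 \<Rightarrow> bool" where
  "ord3_ge n F \<longleftrightarrow> (\<forall>i j k. i + j + k < n \<longrightarrow> F $ i $ j $ k = 0)"

definition const2 :: "'a::comm_ring_1 \<Rightarrow> 'a fps2" where
  "const2 c = fps_const (fps_const c)"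

definition const3 :: "'a::comm_ring_1 \<Rightarrow> 'a fps3" where
  "const3 c = fps_const (fps_const (fps_const c))"

definition monom1 :: "'a::comm_ring_1 \<Rightarrow> nat \<Rightarrow> 'a fps" where
  "monom1 c p = fps_const c * fps_X ^ p"

definition monom2 :: "'a::comm_ring_1 \<Rightarrow> nat \<times> nat \<Rightarrow> 'a fps2" where
  "monom2 c pq = const2 c * x2 ^ fst pq * y2 ^ snd pq"

lemma const3_mult: "const3 (c * d) = const3 c * const3 d"
  by (simp add: const3_def)

lemma const3_1 [simp]: "const3 1 = 1"
  by (simp add: const3_def)

lemma const3_mult_nth: "(const3 c * w) $ i $ j $ k = c * w $ i $ j $ k"
  by (simp add: const3_def)

lemma monom1_nth: "monom1 c p $ i = (if i = p then c else 0)"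
  by (simp add: monom1_def)

lemma monom1_mult: "monom1 c p * monom1 d q = monom1 (c * d) (p + q)"
  unfolding monom1_def fps_const_mult[symmetric] power_add by (simp only: mult_ac)

lemma monom2_nth: "monom2 c pq $ i $ j = (if pq = (i, j) then c else 0)"
proof -
  have "monom2 c pq = fps_const (fps_const c * fps_X ^ snd pq) * fps_X ^ fst pq"
    by (simp add: monom2_def const2_def x2_def y2_def mult_ac fps_const_power
        flip: fps_const_mult)
  then show ?thesis
    by (cases pq) auto
qed

lemma monom2_mult:
  "monom2 c (p, q) * monom2 d (r, s) = monom2 (c * d) (p + r, q + s)"
proof -
  have "const2 (c * d) = const2 c * const2 d"
    by (simp add: const2_def)
  then show ?thesis
    by (simp add: monom2_def power_add mult_ac)
qed

lemma ord1_ge_mult: "ord1_ge n f \<Longrightarrow> ord1_ge n (f * g)"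
  by (auto simp: ord1_ge_def fps_mult_nth intro!: sum.neutral)

lemma ord2_ge_mult: "ord2_ge n F \<Longrightarrow> ord2_ge n (F * H)"
  using mult2_nth_eq_0[of n F 0 H] by (simp add: ord2_ge_def)

lemma ord3_ge_mult: "ord3_ge n F \<Longrightarrow> ord3_ge n (F * H)"
  using mult3_nth_eq_0[of n F 0 H] by (simp add: ord3_ge_def)

text \<open>
  The common features of \<open>A[[x]]\<close> and \<open>A[[x,y]]\<close>: a filtration by ideals for which the polynomials
  are dense.
\<close>

locale filtered_by_monomials =
  fixes ord_ge :: "nat \<Rightarrow> 'r::comm_ring_1 \<Rightarrow> bool"
    and monom :: "'a::comm_ring_1 \<Rightarrow> 'i \<Rightarrow> 'r"
  assumes ord_ge_mult: "ord_ge n f \<Longrightarrow> ord_ge n (f * g)"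
    and ex_approx: "\<exists>I c. ord_ge n (f - (\<Sum>i\<in>I. monom (c i) i))"
begin

definition continuous_additive :: "('r \<Rightarrow> 'a fps3) \<Rightarrow> bool" where
  "continuous_additive \<phi> \<longleftrightarrow>
     (\<forall>f g. \<phi> (f + g) = \<phi> f + \<phi> g) \<and> (\<forall>n f. ord_ge n f \<longrightarrow> ord3_ge n (\<phi> f))"

lemma continuous_additiveI:
  assumes "\<And>f g. \<phi> (f + g) = \<phi> f + \<phi> g" and "\<And>n f. ord_ge n f \<Longrightarrow> ord3_ge n (\<phi> f)"
  shows "continuous_additive \<phi>"
  using assms by (simp add: continuous_additive_def)

lemma continuous_additive_mult_left:
  assumes "continuous_additive \<phi>"
  shows "continuous_additive (\<lambda>f. \<phi> (f * g))"
  using assms by (auto simp: continuous_additive_def distrib_right ord_ge_mult)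

lemma continuous_additive_mult_const:
  assumes "continuous_additive \<phi>"
  shows "continuous_additive (\<lambda>f. \<phi> f * w)"
  using assms by (auto simp: continuous_additive_def distrib_right ord3_ge_mult)

text \<open>
  The remainder after subtracting a polynomial can be pushed into any prescribed degree, so it
  does not affect a given coefficient of \<open>\<phi> f\<close> and \<open>\<psi> f\<close>.
\<close>

lemma eq_if_eq_on_monomials:
  assumes \<phi>: "continuous_additive \<phi>" and \<psi>: "continuous_additive \<psi>"
    and eq: "\<And>c i. \<phi> (monom c i) = \<psi> (monom c i)"
  shows "\<phi> f = \<psi> f"
proof -
  have add: "\<phi> (f + g) = \<phi> f + \<phi> g" "\<psi> (f + g) = \<psi> f + \<psi> g" for f g
    using \<phi> \<psi> by (auto simp: continuous_additive_def)
  have "\<phi> 0 = 0" "\<psi> 0 = 0"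
    using add[of 0 0] by simp_all
  then have eq_sum: "\<phi> (\<Sum>i\<in>I. monom (c i) i) = \<psi> (\<Sum>i\<in>I. monom (c i) i)" for I c
    by (induction I rule: infinite_finite_induct) (simp_all add: add eq)
  have "\<phi> f $ i $ j $ k = \<psi> f $ i $ j $ k" for i j k
  proof -
    obtain I c where "ord_ge (Suc (i + j + k)) (f - (\<Sum>i\<in>I. monom (c i) i))" (is "ord_ge _ ?r")
      using ex_approx by blast
    then have "ord3_ge (Suc (i + j + k)) (\<phi> ?r)" "ord3_ge (Suc (i + j + k)) (\<psi> ?r)"
      using \<phi> \<psi> by (auto simp: continuous_additive_def)
    then have "\<phi> ?r $ i $ j $ k = 0" "\<psi> ?r $ i $ j $ k = 0"
      by (simp_all add: ord3_ge_def)
    moreover have "\<phi> f = \<phi> ?r + \<phi> (\<Sum>i\<in>I. monom (c i) i)"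
      "\<psi> f = \<psi> ?r + \<psi> (\<Sum>i\<in>I. monom (c i) i)"
      by (simp_all flip: add)
    ultimately show ?thesis
      by (simp add: eq_sum)
  qed
  then show ?thesis
    by (simp add: fps_eq_iff)
qed

text \<open>Multiplicativity is a bilinear identity, so the density argument applies to one factor at a time.\<close>

lemma multiplicative_if_on_monomials:
  assumes \<phi>: "continuous_additive \<phi>"
    and mult: "\<And>c i d j. \<phi> (monom c i * monom d j) = \<phi> (monom c i) * \<phi> (monom d j)"
  shows "\<phi> (f * g) = \<phi> f * \<phi> g"
proof (rule eq_if_eq_on_monomials[of "\<lambda>f. \<phi> (f * g)" "\<lambda>f. \<phi> f * \<phi> g"])
  fix c i
  have "\<phi> (g * monom c i) = \<phi> g * \<phi> (monom c i)"
    by (rule eq_if_eq_on_monomials[of "\<lambda>g. \<phi> (g * monom c i)" "\<lambda>g. \<phi> g * \<phi> (monom c i)"])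
       (simp_all add: \<phi> continuous_additive_mult_left continuous_additive_mult_const mult)
  then show "\<phi> (monom c i * g) = \<phi> (monom c i) * \<phi> g"
    by (simp add: mult.commute)
qed (simp_all add: \<phi> continuous_additive_mult_left continuous_additive_mult_const)

end

interpretation A1: filtered_by_monomials ord1_ge "monom1 :: 'a::comm_ring_1 \<Rightarrow> nat \<Rightarrow> 'a fps"
proof
  fix n and f :: "'a fps"
  have "ord1_ge n (f - (\<Sum>i<n. monom1 (f $ i) i))"
    by (simp add: ord1_ge_def fps_sum_nth monom1_nth)
  then show "\<exists>I c. ord1_ge n (f - (\<Sum>i\<in>I. monom1 (c i) i))"
    by (intro exI[of _ "{..<n}"] exI[of _ "\<lambda>i. f $ i"])
qed (rule ord1_ge_mult)

interpretation A2: filtered_by_monomials ord2_ge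
  "monom2 :: 'a::comm_ring_1 \<Rightarrow> nat \<times> nat \<Rightarrow> 'a fps2"
proof
  fix n and F :: "'a fps2"
  let ?c = "\<lambda>pq. F $ fst pq $ snd pq"
  have "(\<Sum>pq\<in>{..<n} \<times> {..<n}. monom2 (?c pq) pq) $ i $ j = F $ i $ j" if "i + j < n" for i j
  proof -
    have "(\<Sum>pq\<in>{..<n} \<times> {..<n}. monom2 (?c pq) pq) $ i $ j
        = (\<Sum>pq\<in>{..<n} \<times> {..<n}. if pq = (i, j) then F $ i $ j else 0)"
      by (simp only: fps_sum_nth monom2_nth) (intro sum.cong, auto)
    also have "\<dots> = F $ i $ j"
      using that by simp
    finally show ?thesis .
  qed
  then have "ord2_ge n (F - (\<Sum>pq\<in>{..<n} \<times> {..<n}. monom2 (?c pq) pq))"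
    by (simp add: ord2_ge_def)
  then show "\<exists>I c. ord2_ge n (F - (\<Sum>i\<in>I. monom2 (c i) i))"
    by (intro exI[of _ "{..<n} \<times> {..<n}"] exI[of _ ?c])
qed (rule ord2_ge_mult)


section \<open>Substitution\<close>

text \<open>
  After \<open>u\<close> and \<open>v\<close> are substituted into \<open>H(G(x) + G(y))\<close>, the series \<open>G\<close> and \<open>H\<close> are evaluated at
  elements of \<open>A[[x,y,z]]\<close>.
\<close>

definition subst_1_3 :: "'a::comm_ring_1 fps \<Rightarrow> 'a fps3 \<Rightarrow> 'a fps3" where
  "subst_1_3 f u = Abs_fps (\<lambda>i. Abs_fps (\<lambda>j. Abs_fps (\<lambda>k.
     \<Sum>p\<le>i+j+k. f $ p * (u ^ p) $ i $ j $ k)))"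

lemma subst_1_3_nth_0 [simp]: "subst_1_3 f u $ 0 $ 0 $ 0 = f $ 0"
  by (simp add: subst_1_3_def)

lemma subst_1_2_nth_0 [simp]: "subst_1_2 f u $ 0 $ 0 = f $ 0"
  by (simp add: subst_1_2_def)

lemma subst_2_3_nth_0 [simp]: "subst_2_3 F u v $ 0 $ 0 $ 0 = F $ 0 $ 0"
  by (simp add: subst_2_3_def)

lemma subst_1_3_0 [simp]:
  assumes "f $ 0 = 0"
  shows "subst_1_3 f 0 = 0"
  using assms by (auto simp: subst_1_3_def fps_eq_iff power_0_left intro!: sum.neutral)

lemma subst_1_2_add: "subst_1_2 (f + g) u = subst_1_2 f u + subst_1_2 g u"
  by (simp add: subst_1_2_def fps_eq_iff distrib_right sum.distrib)

lemma ord2_ge_subst_1_2: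
  assumes "u $ 0 $ 0 = 0" "ord1_ge n f"
  shows "ord2_ge n (subst_1_2 f u)"
  using assms(2) by (auto simp: ord1_ge_def ord2_ge_def subst_1_2_def intro!: sum.neutral)

lemma subst_1_2_monom1:
  assumes "u $ 0 $ 0 = 0"
  shows "subst_1_2 (monom1 c p) u = const2 c * u ^ p"
  using power2_nth_eq_0[OF assms]
  by (auto simp: fps_eq_iff subst_1_2_def monom1_nth const2_def if_distrib[of "\<lambda>x. x * _"] not_le
      cong: if_cong)

lemma subst_1_3_monom1:
  assumes "u $ 0 $ 0 $ 0 = 0"
  shows "subst_1_3 (monom1 c p) u = const3 c * u ^ p"
  using power3_nth_eq_0[OF assms]
  by (auto simp: fps_eq_iff subst_1_3_def monom1_nth const3_mult_nth
      if_distrib[of "\<lambda>x. x * _"] not_le cong: if_cong)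

lemma continuous_additive_subst_1_3: "A1.continuous_additive (\<lambda>f. subst_1_3 f u)"
  by (rule A1.continuous_additiveI)
     (auto simp: subst_1_3_def fps_eq_iff distrib_right sum.distrib ord1_ge_def ord3_ge_def
       intro!: sum.neutral)

lemma subst_1_3_mult:
  assumes "u $ 0 $ 0 $ 0 = 0"
  shows "subst_1_3 (f * g) u = subst_1_3 f u * subst_1_3 g u"
  by (rule A1.multiplicative_if_on_monomials[OF continuous_additive_subst_1_3])
     (simp add: monom1_mult subst_1_3_monom1[OF assms] const3_mult power_add mult_ac)

lemma subst_1_3_const:
  assumes "u $ 0 $ 0 $ 0 = 0"
  shows "subst_1_3 (fps_const c) u = const3 c"
  using subst_1_3_monom1[OF assms, of c 0] by (simp add: monom1_def)

lemma subst_1_3_power: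
  assumes "u $ 0 $ 0 $ 0 = 0"
  shows "subst_1_3 (f ^ n) u = subst_1_3 f u ^ n"
proof (induction n)
  case 0
  show ?case
    using subst_1_3_const[OF assms, of 1] by simp
qed (simp add: subst_1_3_mult[OF assms])

lemma subst_1_3_fps_X:
  assumes "u $ 0 $ 0 $ 0 = 0"
  shows "subst_1_3 fps_X u = u"
  using subst_1_3_monom1[OF assms, of 1 1] by (simp add: monom1_def)

text \<open>
  For fixed \<open>g\<close> and \<open>u\<close> both sides are additive and continuous in \<open>f\<close>; for \<open>f = c X\<^sup>p\<close> both are
  \<open>c \<cdot> g(u)\<^sup>p\<close>, because substituting \<open>u\<close> is multiplicative.
\<close>

lemma subst_1_3_compose:
  assumes u: "u $ 0 $ 0 $ 0 = 0" and g: "g $ 0 = 0"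
  shows "subst_1_3 (f oo g) u = subst_1_3 f (subst_1_3 g u)"
proof (rule A1.eq_if_eq_on_monomials
    [of "\<lambda>f. subst_1_3 (f oo g) u" "\<lambda>f. subst_1_3 f (subst_1_3 g u)"])
  have "ord1_ge n (f oo g)" if "ord1_ge n f" for n and f :: "'a fps"
    using that by (auto simp: ord1_ge_def fps_compose_nth intro!: sum.neutral)
  then show "A1.continuous_additive (\<lambda>f. subst_1_3 (f oo g) u)"
    using continuous_additive_subst_1_3[of u]
    by (simp add: A1.continuous_additive_def fps_compose_add_distrib)
next
  fix c :: 'a and p
  have "(g ^ p) $ n = 0" if "n < p" for n
    using that g startsby_zero_power_prefix by blast
  then have "monom1 c p oo g = fps_const c * g ^ p"
    by (auto simp: fps_eq_iff fps_compose_nth monom1_nth if_distrib[of "\<lambda>x. x * _"] not_le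
        cong: if_cong)
  then show "subst_1_3 (monom1 c p oo g) u = subst_1_3 (monom1 c p) (subst_1_3 g u)"
    using u g
    by (simp add: subst_1_3_monom1 subst_1_3_mult subst_1_3_const subst_1_3_power)
qed (rule continuous_additive_subst_1_3)

lemma subst_2_3_add: "subst_2_3 (F + H) u v = subst_2_3 F u v + subst_2_3 H u v"
  by (simp add: subst_2_3_def fps_eq_iff distrib_right sum.distrib)

lemma subst_2_3_monom2:
  assumes "u $ 0 $ 0 $ 0 = 0" "v $ 0 $ 0 $ 0 = 0"
  shows "subst_2_3 (monom2 c (p, q)) u v = const3 c * (u ^ p * v ^ q)"
proof -
  have "(\<Sum>a\<le>N. \<Sum>b\<le>N. monom2 c (p, q) $ a $ b * (u ^ a * v ^ b) $ i $ j $ k)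
      = c * (u ^ p * v ^ q) $ i $ j $ k" if N: "N = i + j + k" for N i j k
  proof -
    have "(\<Sum>a\<le>N. \<Sum>b\<le>N. monom2 c (p, q) $ a $ b * (u ^ a * v ^ b) $ i $ j $ k)
        = (\<Sum>a\<le>N. \<Sum>b\<le>N. if a = p then if b = q then c * (u ^ p * v ^ q) $ i $ j $ k else 0 else 0)"
      by (intro sum.cong) (auto simp: monom2_nth)
    also have "\<dots> = (\<Sum>a\<le>N. if a = p then
        \<Sum>b\<le>N. if b = q then c * (u ^ p * v ^ q) $ i $ j $ k else 0 else 0)"
      by (intro sum.cong) auto
    also have "\<dots> = (if p \<le> N \<and> q \<le> N then c * (u ^ p * v ^ q) $ i $ j $ k else 0)"
      by simp
    also have "\<dots> = c * (u ^ p * v ^ q) $ i $ j $ k"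
      using power_mult_power3_nth_eq_0[OF assms, of i j k p q] N by auto
    finally show ?thesis .
  qed
  then show ?thesis
    by (simp add: fps_eq_iff subst_2_3_def const3_mult_nth)
qed

text \<open>
  A term \<open>F\<^sub>p\<^sub>q u\<^sup>p v\<^sup>q\<close> with \<open>p + q < n\<close> vanishes because \<open>F\<^sub>p\<^sub>q\<close> does, any other because
  \<open>u\<^sup>p v\<^sup>q\<close> starts in degree \<open>p + q\<close>.
\<close>

lemma ord3_ge_subst_2_3:
  assumes "u $ 0 $ 0 $ 0 = 0" "v $ 0 $ 0 $ 0 = 0" and F: "ord2_ge n F"
  shows "ord3_ge n (subst_2_3 F u v)"
  unfolding ord3_ge_def
proof (intro allI impI)
  fix i j k
  assume "i + j + k < n"
  then have "F $ p $ q * (u ^ p * v ^ q) $ i $ j $ k = 0" for p q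
    using F power_mult_power3_nth_eq_0[OF assms(1,2), of i j k p q]
    by (cases "p + q < n") (auto simp: ord2_ge_def)
  then show "subst_2_3 F u v $ i $ j $ k = 0"
    by (simp add: subst_2_3_def)
qed

lemma continuous_additive_subst_2_3:
  assumes "u $ 0 $ 0 $ 0 = 0" "v $ 0 $ 0 $ 0 = 0"
  shows "A2.continuous_additive (\<lambda>F. subst_2_3 F u v)"
  by (intro A2.continuous_additiveI subst_2_3_add ord3_ge_subst_2_3 assms)

lemma subst_2_3_mult:
  assumes "u $ 0 $ 0 $ 0 = 0" "v $ 0 $ 0 $ 0 = 0"
  shows "subst_2_3 (F * H) u v = subst_2_3 F u v * subst_2_3 H u v"
proof (rule A2.multiplicative_if_on_monomials[OF continuous_additive_subst_2_3[OF assms]])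
  fix c d :: 'a and i j :: "nat \<times> nat"
  show "subst_2_3 (monom2 c i * monom2 d j) u v
      = subst_2_3 (monom2 c i) u v * subst_2_3 (monom2 d j) u v"
    by (cases i; cases j)
       (simp add: monom2_mult subst_2_3_monom2[OF assms] const3_mult power_add mult_ac)
qed

lemma subst_2_3_const2:
  assumes "u $ 0 $ 0 $ 0 = 0" "v $ 0 $ 0 $ 0 = 0"
  shows "subst_2_3 (const2 c) u v = const3 c"
  using subst_2_3_monom2[OF assms, of c 0 0] by (simp add: monom2_def)

lemma subst_2_3_power:
  assumes "u $ 0 $ 0 $ 0 = 0" "v $ 0 $ 0 $ 0 = 0"
  shows "subst_2_3 (F ^ n) u v = subst_2_3 F u v ^ n"
proof (induction n)
  case 0
  show ?case
    using subst_2_3_const2[OF assms, of 1] by (simp add: const2_def)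
qed (simp add: subst_2_3_mult[OF assms])

lemma subst_2_3_x2:
  assumes "u $ 0 $ 0 $ 0 = 0" "v $ 0 $ 0 $ 0 = 0"
  shows "subst_2_3 x2 u v = u"
  using subst_2_3_monom2[OF assms, of 1 1 0] by (simp add: monom2_def const2_def)

lemma subst_2_3_y2:
  assumes "u $ 0 $ 0 $ 0 = 0" "v $ 0 $ 0 $ 0 = 0"
  shows "subst_2_3 y2 u v = v"
  using subst_2_3_monom2[OF assms, of 1 0 1] by (simp add: monom2_def const2_def)

text \<open>As for \<open>subst_1_3_compose\<close>: for \<open>f = c X\<^sup>p\<close> both sides are \<open>c \<cdot> W(u,v)\<^sup>p\<close>.\<close>

lemma subst_2_3_subst_1_2:
  assumes u: "u $ 0 $ 0 $ 0 = 0" and v: "v $ 0 $ 0 $ 0 = 0" and W: "W $ 0 $ 0 = 0"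
  shows "subst_2_3 (subst_1_2 f W) u v = subst_1_3 f (subst_2_3 W u v)"
proof (rule A1.eq_if_eq_on_monomials
    [of "\<lambda>f. subst_2_3 (subst_1_2 f W) u v" "\<lambda>f. subst_1_3 f (subst_2_3 W u v)"])
  show "A1.continuous_additive (\<lambda>f. subst_2_3 (subst_1_2 f W) u v)"
    by (intro A1.continuous_additiveI)
       (simp_all add: subst_1_2_add subst_2_3_add ord3_ge_subst_2_3 u v ord2_ge_subst_1_2 W)
next
  show "subst_2_3 (subst_1_2 (monom1 c p) W) u v
      = subst_1_3 (monom1 c p) (subst_2_3 W u v)" for c p
    using u v W
    by (simp add: subst_1_2_monom1 subst_1_3_monom1 subst_2_3_mult subst_2_3_const2
        subst_2_3_power)
qed (rule continuous_additive_subst_1_3)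


section \<open>The formal ring with a given logarithm\<close>

text \<open>
  Once \<open>\<Phi>(u,v) = h(g(u) + g(v))\<close> and \<open>\<Psi>(u,v) = h(g(u) \<cdot> g(v))\<close> are known for all \<open>u, v\<close> without
  constant term, every inner \<open>g(h(w))\<close> cancels and only ring identities remain.
\<close>

theorem formal_ring_of_log:
  fixes g h :: "'a::comm_ring_1 fps"
  assumes g: "g $ 0 = 0" and h: "h $ 0 = 0" and gh: "g oo h = fps_X" and hg: "h oo g = fps_X"
  shows "formal_ring (subst_1_2 h (subst_1_2 g x2 + subst_1_2 g y2))
                     (subst_1_2 h (subst_1_2 g x2 * subst_1_2 g y2))"
proof -
  have log_exp: "subst_1_3 g (subst_1_3 h w) = w" if "w $ 0 $ 0 $ 0 = 0" for w :: "'a fps3"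
    using that h gh subst_1_3_compose[of w h g] by (simp add: subst_1_3_fps_X)
  have exp_log: "subst_1_3 h (subst_1_3 g w) = w" if "w $ 0 $ 0 $ 0 = 0" for w :: "'a fps3"
    using that g hg subst_1_3_compose[of w g h] by (simp add: subst_1_3_fps_X)
  have xy [simp]: "x2 $ 0 $ 0 = (0::'a)" "y2 $ 0 $ 0 = (0::'a)"
    by (simp_all add: x2_def y2_def)
  have xyz: "x3 $ 0 $ 0 $ 0 = (0::'a)" "y3 $ 0 $ 0 $ 0 = (0::'a)" "z3 $ 0 $ 0 $ 0 = (0::'a)"
    by (simp_all add: x3_def y3_def z3_def)
  define \<Phi> where "\<Phi> = subst_1_2 h (subst_1_2 g x2 + subst_1_2 g y2)"
  define \<Psi> where "\<Psi> = subst_1_2 h (subst_1_2 g x2 * subst_1_2 g y2)"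
  have zero: "\<Phi> $ 0 $ 0 = 0" "\<Psi> $ 0 $ 0 = 0"
    by (simp_all add: \<Phi>_def \<Psi>_def h)
  have sum: "subst_2_3 \<Phi> u v = subst_1_3 h (subst_1_3 g u + subst_1_3 g v)"
    if "u $ 0 $ 0 $ 0 = 0" "v $ 0 $ 0 $ 0 = 0" for u v
    using that g
    by (simp add: \<Phi>_def subst_2_3_subst_1_2 subst_2_3_add subst_2_3_x2 subst_2_3_y2)
  have prod: "subst_2_3 \<Psi> u v = subst_1_3 h (subst_1_3 g u * subst_1_3 g v)"
    if "u $ 0 $ 0 $ 0 = 0" "v $ 0 $ 0 $ 0 = 0" for u v
    using that g
    by (simp add: \<Psi>_def subst_2_3_subst_1_2 subst_2_3_mult subst_2_3_x2 subst_2_3_y2)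
  have "formal_ring \<Phi> \<Psi>"
    unfolding formal_ring_def formal_group_law_def
    by (simp add: sum prod log_exp exp_log xyz zero g h distrib_left distrib_right add_ac mult_ac)
  then show ?thesis
    by (simp add: \<Phi>_def \<Psi>_def)
qed


section \<open>Compositional inverses\<close>

text \<open>
  \<open>left_inv_coeff f\<close> solves \<open>(\<Sum>\<^sub>i\<^sub>\<le>\<^sub>n h\<^sub>i (f\<^sup>i)\<^sub>n) = X\<^sub>n\<close> for \<open>h\<^sub>n\<close>; the coefficient \<open>(f\<^sup>n)\<^sub>n\<close> of
  \<open>h\<^sub>n\<close> is \<open>1\<close> when \<open>f = X + \<dots>\<close>, so no division occurs.
\<close>

fun left_inv_coeff :: "'a::comm_ring_1 fps \<Rightarrow> nat \<Rightarrow> 'a" where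
  "left_inv_coeff f n = fps_X $ n - (\<Sum>i<n. left_inv_coeff f i * (f ^ i) $ n)"

declare left_inv_coeff.simps [simp del]

lemma ex_left_inverse:
  fixes f :: "'a::comm_ring_1 fps"
  assumes f: "f $ 0 = 0" "f $ 1 = 1"
  obtains h where "h $ 0 = 0" "h $ 1 = 1" "h oo f = fps_X"
proof
  let ?h = "Abs_fps (left_inv_coeff f)"
  show h0: "?h $ 0 = 0"
    by (simp add: left_inv_coeff.simps[of f 0])
  then show "?h $ 1 = 1"
    by (simp add: left_inv_coeff.simps[of f "Suc 0"] left_inv_coeff.simps[of f 0])
  show "?h oo f = fps_X"
  proof (rule fps_ext)
    fix n
    have "(f ^ n) $ n = 1"
      using f startsby_zero_power_nth_same[of f n] by simp
    moreover have "(?h oo f) $ n = (\<Sum>i<n. ?h $ i * (f ^ i) $ n) + ?h $ n * (f ^ n) $ n"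
      by (simp add: fps_compose_nth atLeast0AtMost flip: lessThan_Suc_atMost)
    ultimately show "(?h oo f) $ n = fps_X $ n"
      by (simp add: left_inv_coeff.simps[of f n])
  qed
qed

text \<open>
  The left inverse \<open>h\<close> of \<open>f\<close> is again of the form \<open>X + \<dots>\<close>, so it has a left inverse \<open>k\<close> itself.
  Associativity forces \<open>k = f\<close>, which makes \<open>h\<close> a right inverse of \<open>f\<close> as well.
\<close>

lemma comp_inverse:
  fixes f :: "'a::idom fps"
  assumes f: "f $ 0 = 0" "f $ 1 = 1"
  shows "comp_inverse f $ 0 = 0 \<and> f oo comp_inverse f = fps_X \<and> comp_inverse f oo f = fps_X"
  unfolding comp_inverse_def
proof (rule theI')
  obtain h where h: "h $ 0 = 0" "h $ 1 = 1" "h oo f = fps_X"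
    using ex_left_inverse[OF f] .
  obtain k where k: "k $ 0 = 0" "k oo h = fps_X"
    using ex_left_inverse[OF h(1,2)] .
  have "k = k oo (h oo f)"
    by (simp add: h)
  also have "\<dots> = (k oo h) oo f"
    using f h by (intro fps_compose_assoc) auto
  also have "\<dots> = f"
    using k f by simp
  finally have "f oo h = fps_X"
    using k by simp
  moreover have "h' = h" if "h' $ 0 = 0" "f oo h' = fps_X" for h'
  proof -
    have "h' = (h oo f) oo h'"
      using that h by simp
    also have "\<dots> = h oo (f oo h')"
      using that f by (intro fps_compose_assoc[symmetric]) auto
    finally show ?thesis
      using that by simp
  qed
  ultimately show "\<exists>!h. h $ 0 = 0 \<and> f oo h = fps_X \<and> h oo f = fps_X"
    using h by blast
qed


section \<open>The universal logarithm\<close>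

lemma G\<^sub>U_nth_0: "G\<^sub>U $ 0 = 0"
  by (simp add: G\<^sub>U_def)

lemma G\<^sub>U_nth_1: "G\<^sub>U $ 1 = 1"
  using is_ring_hom_\<iota>\<^sub>B is_ring_hom_\<iota>\<^sub>Q by (simp add: G\<^sub>U_def a_var_def is_ring_hom_def)

theorem theorem1:
  shows "formal_ring \<Phi>\<^sub>U \<Psi>\<^sub>U"
  unfolding \<Phi>\<^sub>U_def \<Psi>\<^sub>U_def
  using comp_inverse[OF G\<^sub>U_nth_0 G\<^sub>U_nth_1] G\<^sub>U_nth_0 by (intro formal_ring_of_log) auto

end
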